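(* Let $\Gamma$ be a simple graph with $s$ edges, let $G$ be a group of order $mn$ with $\lambda(m-1)n=2st$ for positive integers $\lambda,t$, and let $H$ be a subgroup of $G$ of order $n$. Assume that $A$ is a subgroup of $\mathrm{Aut}(G)$ whose order $d$ divides $\gcd(mn-n,t)$ and which acts semiregularly on $G\setminus H$. Assume also that $\mathcal{I}$ is a collection of $t/d$ $\Gamma$-subgraphs of $\mathbb{K}_{G:H}$ such that $\Delta\mathcal{I}$ is evenly distributed over the $(m-1)n/d$ orbits of $A$ on $G\setminus H$. Then $\mathcal{I}$ is a collection of initial base blocks of an $(mn,n,\Gamma,\lambda)$ difference family in $G$ relative to $H$, i.e., the family $(B^\alpha)_{B\in\mathcal{I},\,\alpha\in A}$ is such a difference family.
   Context: $G$ is written multiplicatively. $\mathbb{K}_{G:H}$ is the complete multipartite graph with vertex set $G$ whose parts are the right cosets of $H$ in $G$; a $\Gamma$-subgraph is a subgraph isomorphic to $\Gamma$. For a graph $B$ with vertices in $G$, $\Delta B$ is the multiset of $xy^{-1}$ over all ordered pairs $(x,y)$ of adjacent vertices; $\Delta$ of a collection is the multiset union. For $\alpha\in\mathrm{Aut}(G)$, $B^\alpha$ is obtained by applying $\alpha$ to the vertices of $B$. Semiregular on $G\setminus H$: no non-identity element of $A$ fixes an element of $G\setminus H$. Evenly distributed: every $A$-orbit on $G\setminus H$ contains the same number of elements of $\Delta\mathcal{I}$ (with multiplicity). An $(mn,n,\Gamma,\lambda)$ difference family in $G$ relative to $H$ is a collection of $\Gamma$-subgraphs of $\mathbb{K}_{G:H}$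 whose list of differences contains every element of $G\setminus H$ exactly $\lambda$ times. *)

theory Defs
  imports
    "HOL-Library.Multiset"
    "HOL-Algebra.Group_Action"
    "Graph_Theory.Pair_Digraph"
    "Graph_Theory.Digraph_Component"
    "Graph_Theory.Digraph_Isomorphism"
begin

text \<open>
  A finite simple graph is a \<open>pair_graph\<close>: a finite loop-free symmetric relation \<^const>\<open>parcs\<close>
  on \<^const>\<open>pverts\<close>. Hence \<^const>\<open>parcs\<close> is the set of ordered pairs of adjacent vertices,
  and every edge is counted there twice.
\<close>

definition uedges :: "'a pair_pre_digraph \<Rightarrow> 'a set set" where
  "uedges B = (\<lambda>(x, y). {x, y}) ` parcs B"

definition complete_multipartite :: "'a set set \<Rightarrow> 'a pair_pre_digraph" where
  "complete_multipartite parts =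
     \<lparr>pverts = \<Union>parts,
      parcs = {(x, y). \<exists>P\<in>parts. \<exists>Q\<in>parts. P \<noteq> Q \<and> x \<in> P \<and> y \<in> Q}\<rparr>"

definition coset_multipartite :: "('a, 'b) monoid_scheme \<Rightarrow> 'a set \<Rightarrow> 'a pair_pre_digraph" where
  "coset_multipartite G H = complete_multipartite (rcosets\<^bsub>G\<^esub> H)"

definition iso_subgraph ::
    "'v pair_pre_digraph \<Rightarrow> 'a pair_pre_digraph \<Rightarrow> 'a pair_pre_digraph \<Rightarrow> bool" where
  "iso_subgraph \<Gamma> K B \<longleftrightarrow>
     subgraph (with_proj B) (with_proj K) \<and> digraph_iso (with_proj B) (with_proj \<Gamma>)"

definition differences :: "('a, 'b) monoid_scheme \<Rightarrow> 'a pair_pre_digraph \<Rightarrow> 'a multiset" where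
  "differences G B = {# x \<otimes>\<^bsub>G\<^esub> inv\<^bsub>G\<^esub> y. (x, y) \<in># mset_set (parcs B) #}"

definition differences_family ::
    "('a, 'b) monoid_scheme \<Rightarrow> 'a pair_pre_digraph multiset \<Rightarrow> 'a multiset" where
  "differences_family G \<F> = (\<Sum>B\<in>#\<F>. differences G B)"

definition graph_image :: "('a \<Rightarrow> 'c) \<Rightarrow> 'a pair_pre_digraph \<Rightarrow> 'c pair_pre_digraph" where
  "graph_image \<alpha> B = \<lparr>pverts = \<alpha> ` pverts B, parcs = map_prod \<alpha> \<alpha> ` parcs B\<rparr>"

definition developed_blocks ::
    "('a \<Rightarrow> 'a) set \<Rightarrow> 'a pair_pre_digraph multiset \<Rightarrow> 'a pair_pre_digraph multiset" where
  "developed_blocks A \<I> = (\<Sum>B\<in>#\<I>. {# graph_image \<alpha> B. \<alpha> \<in># mset_set A #})"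

locale semiregular_action = group_action +
  assumes semiregular: "\<lbrakk>g \<in> carrier G; g \<noteq> \<one>; x \<in> E\<rbrakk> \<Longrightarrow> \<phi> g x \<noteq> x"

abbreviation Aut_subgroup ::
    "('a, 'b) monoid_scheme \<Rightarrow> ('a \<Rightarrow> 'a) set \<Rightarrow> ('a \<Rightarrow> 'a) monoid" where
  "Aut_subgroup G A \<equiv> (AutoGroup G)\<lparr>carrier := A\<rparr>"

text \<open>
  Permutations of \<open>E\<close> in the library are extensional, so the natural action of automorphisms of
  \<open>G\<close> on a subset \<open>E\<close> of \<open>G\<close> is by their restrictions to \<open>E\<close>. That these form a group action
  includes the invariance of \<open>E\<close>.
\<close>

abbreviation restricted_action :: "'a set \<Rightarrow> ('a \<Rightarrow> 'a) \<Rightarrow> 'a \<Rightarrow> 'a" where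
  "restricted_action E \<equiv> (\<lambda>\<alpha>. restrict \<alpha> E)"

definition evenly_distributed :: "'a multiset \<Rightarrow> 'a set set \<Rightarrow> bool" where
  "evenly_distributed D Os \<longleftrightarrow> (\<exists>c. \<forall>S\<in>Os. size {# x \<in># D. x \<in> S #} = c)"

definition relative_difference_family ::
    "('a, 'b) monoid_scheme \<Rightarrow> 'a set \<Rightarrow> nat \<Rightarrow> nat \<Rightarrow> 'v pair_pre_digraph \<Rightarrow> nat
     \<Rightarrow> 'a pair_pre_digraph multiset \<Rightarrow> bool" where
  "relative_difference_family G H v k \<Gamma> \<mu> \<F> \<longleftrightarrow>
     group G \<and> finite (carrier G) \<and> order G = v \<and> subgroup H G \<and> card H = k \<and>
     (\<forall>B\<in>#\<F>. iso_subgraph \<Gamma> (coset_multipartite G H) B) \<and>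
     (\<forall>g\<in>carrier G - H. count (differences_family G \<F>) g = \<mu>)"

end

theory Submission
  imports Defs
begin

text \<open>
  Semiregularity makes \<open>\<alpha> \<mapsto> \<alpha>(x)\<close> a bijection from \<open>A\<close> onto the orbit of \<open>x\<close>, so each
  \<open>x\<close> in \<open>\<Delta>\<I>\<close> contributes every element of its orbit exactly once to the differences of the
  developed family. Hence the multiplicity of \<open>g\<close> there is the number of elements of \<open>\<Delta>\<I>\<close> in the
  orbit of \<open>g\<close>, which is a constant \<open>c\<close> by even distribution. Counting all differences gives
  \<open>c (m - 1) n = 2 s t\<close>, whence \<open>c = \<lambda>\<close>.
\<close>

section \<open>Arcs and isomorphisms of graphs\<close>

text \<open>Each edge is the image of exactly its two orientations, which differ because there are
  no loops. This is the source of the factor 2 in \<open>2 * s * t\<close>.\<close>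

lemma (in pair_graph) card_parcs: "card (parcs G) = 2 * card (uedges G)"
proof -
  let ?f = "\<lambda>(x, y). {x, y}"
  have "card {a \<in> parcs G. ?f a = e} = 2" if "e \<in> ?f ` parcs G" for e
  proof -
    from that obtain x y where xy: "(x, y) \<in> parcs G" "e = {x, y}" by auto
    then have "x \<noteq> y" "(y, x) \<in> parcs G"
      using no_loops' arcs_symmetric by auto
    with xy have "{a \<in> parcs G. ?f a = e} = {(x, y), (y, x)}"
      by (auto simp: doubleton_eq_iff)
    with \<open>x \<noteq> y\<close> show ?thesis by simp
  qed
  then have "(\<Sum>a\<in>parcs G. 1) = (\<Sum>e\<in>?f ` parcs G. 2 :: nat)"
    by (subst sum.image_gen[OF pair_finite_arcs, where g = ?f]) (intro sum.cong; simp)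
  then show ?thesis by (simp add: uedges_def)
qed

lemma digraph_iso_card_arcs:
  assumes "digraph_iso G H"
  shows "card (arcs H) = card (arcs G)"
proof -
  obtain f where "pre_digraph.digraph_isomorphism G f" and H: "H = app_iso f G"
    using assms by (auto simp: digraph_iso_def)
  then have "inj_on (iso_arcs f) (arcs G)"
    by (simp add: pre_digraph.digraph_isomorphism_def)
  then show ?thesis
    by (simp add: H card_image)
qed

lemma digraph_iso_graph_image:
  assumes "pair_wf_digraph B" and inj: "inj_on \<alpha> (pverts B)"
  shows "digraph_iso (with_proj B) (with_proj (graph_image \<alpha> B))"
proof -
  interpret pair_wf_digraph B by fact
  \<comment> \<open>Arcs are pairs, so the vertex map determines the arc map, and the projections
    remain tail and head.\<close>
  let ?f = "\<lparr>iso_verts = \<alpha>, iso_arcs = map_prod \<alpha> \<alpha>, iso_head = snd, iso_tail = fst\<rparr>"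
  have "inj_on (map_prod \<alpha> \<alpha>) (parcs B)"
    using map_prod_inj_on[OF inj inj] by (rule inj_on_subset) (auto dest: wellformed')
  then have "pre_digraph.digraph_isomorphism (with_proj B) ?f"
    using inj by (auto simp: pre_digraph.digraph_isomorphism_def wf_digraph_axioms)
  moreover have "with_proj (graph_image \<alpha> B) = app_iso ?f (with_proj B)"
    by (simp add: app_iso_def with_proj_def graph_image_def)
  ultimately show ?thesis
    unfolding digraph_iso_def by blast
qed

section \<open>The complete multipartite graph on the cosets\<close>

lemma (in group) pverts_coset_multipartite:
  "subgroup H G \<Longrightarrow> pverts (coset_multipartite G H) = carrier G"
  by (simp add: coset_multipartite_def complete_multipartite_def rcosets_part_G)

text \<open>Right cosets of \<open>x\<close> and \<open>y\<close> coincide iff the quotient of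
  \<open>x\<close> by \<open>y\<close> is in \<open>H\<close>. Adjacency thus becomes a condition on
  the difference alone, which automorphisms transport.\<close>

lemma (in group) parcs_coset_multipartite:
  assumes H: "subgroup H G"
  shows "(x, y) \<in> parcs (coset_multipartite G H) \<longleftrightarrow>
    x \<in> carrier G \<and> y \<in> carrier G \<and> x \<otimes> inv y \<notin> H"
proof -
  have coset_eq: "H #> a = H #> x" if "x \<in> H #> a" "a \<in> carrier G" for a x
    using repr_independence[OF that H] .
  have "H #> x = H #> y \<longleftrightarrow> x \<otimes> inv y \<in> H" if "x \<in> carrier G" "y \<in> carrier G"
    using that H subgroup.rcos_module[OF H is_group, of y x] rcos_self[OF _ H, of x]
      coset_eq[of x y] by auto
  moreover have "(x, y) \<in> parcs (coset_multipartite G H) \<longleftrightarrow>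
    x \<in> carrier G \<and> y \<in> carrier G \<and> H #> x \<noteq> H #> y"
  proof
    assume "(x, y) \<in> parcs (coset_multipartite G H)"
    then obtain a b where ab: "a \<in> carrier G" "b \<in> carrier G" "H #> a \<noteq> H #> b"
        "x \<in> H #> a" "y \<in> H #> b"
      by (auto simp: coset_multipartite_def complete_multipartite_def RCOSETS_def)
    then show "x \<in> carrier G \<and> y \<in> carrier G \<and> H #> x \<noteq> H #> y"
      using subgroup.elemrcos_carrier[OF H is_group] coset_eq by metis
  next
    assume "x \<in> carrier G \<and> y \<in> carrier G \<and> H #> x \<noteq> H #> y"
    moreover from this have "x \<in> H #> x" "y \<in> H #> y"
      using rcos_self[OF _ H] by auto
    ultimately show "(x, y) \<in> parcs (coset_multipartite G H)"
      by (auto simp: coset_multipartite_def complete_multipartite_def RCOSETS_def)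
  qed
  ultimately show ?thesis by blast
qed

section \<open>Images of blocks\<close>

lemma iso_subgraph_pair_wf_digraph: "iso_subgraph \<Gamma> K B \<Longrightarrow> pair_wf_digraph B"
  by (auto simp: iso_subgraph_def subgraph_def wf_digraph_wp_iff)

lemma iso_subgraph_pverts: "iso_subgraph \<Gamma> K B \<Longrightarrow> pverts B \<subseteq> pverts K"
  by (auto simp: iso_subgraph_def subgraph_def)

lemma iso_subgraph_parcs: "iso_subgraph \<Gamma> K B \<Longrightarrow> parcs B \<subseteq> parcs K"
  by (auto simp: iso_subgraph_def subgraph_def)

lemma iso_subgraph_graph_image:
  assumes B: "iso_subgraph \<Gamma> K B" and inj: "inj_on \<alpha> (pverts K)"
    and verts: "\<alpha> ` pverts K \<subseteq> pverts K"
    and arcs: "\<And>x y. (x, y) \<in> parcs K \<Longrightarrow> (\<alpha> x, \<alpha> y) \<in> parcs K"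
  shows "iso_subgraph \<Gamma> K (graph_image \<alpha> B)"
proof -
  interpret B: pair_wf_digraph B using B by (rule iso_subgraph_pair_wf_digraph)
  have iso: "digraph_iso (with_proj B) (with_proj (graph_image \<alpha> B))"
    using inj_on_subset[OF inj iso_subgraph_pverts[OF B]] B.pair_wf_digraph_axioms
    by (intro digraph_iso_graph_image)
  \<comment> \<open>The isomorphism from \<open>B\<close> to its image is reversed and then composed
    with the one from \<open>B\<close> to \<open>\<Gamma>\<close>.\<close>
  have "digraph_iso (with_proj (graph_image \<alpha> B)) (with_proj \<Gamma>)"
    using digraph_iso_swap[OF B.wf_digraph_axioms iso] B
    unfolding iso_subgraph_def by (blast intro: digraph_iso_trans)
  moreover have "pair_wf_digraph (graph_image \<alpha> B)"
    by unfold_locales (auto simp: graph_image_def dest: B.wellformed')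
  moreover have "pair_wf_digraph K"
    using B by (auto simp: iso_subgraph_def subgraph_def wf_digraph_wp_iff)
  moreover have "pverts (graph_image \<alpha> B) \<subseteq> pverts K"
    using iso_subgraph_pverts[OF B] verts by (auto simp: graph_image_def)
  moreover have "parcs (graph_image \<alpha> B) \<subseteq> parcs K"
    using iso_subgraph_parcs[OF B] arcs by (auto simp: graph_image_def)
  ultimately show ?thesis
    by (simp add: iso_subgraph_def subgraph_def wf_digraph_wp_iff compatibleI_with_proj)
qed

section \<open>Differences of developed blocks\<close>

lemma size_differences: "size (differences G B) = card (parcs B)"
  by (simp add: differences_def)

text \<open>A homomorphism commutes with forming differences; injectivity keeps distinct arcs
  distinct, so multiplicities survive.\<close>

lemma (in group) differences_graph_image:
  assumes \<alpha>: "\<alpha> \<in> hom G G" "inj_on \<alpha> (carrier G)" and arcs: "parcs B \<subseteq> carrier G \<times> carrier G"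
  shows "differences G (graph_image \<alpha> B) = image_mset \<alpha> (differences G B)"
proof (cases "finite (parcs B)")
  case True
  interpret \<alpha>: group_hom G G \<alpha>
    using \<alpha> by unfold_locales
  have inj: "inj_on (map_prod \<alpha> \<alpha>) (parcs B)"
    using map_prod_inj_on[OF \<alpha>(2) \<alpha>(2)] arcs by (rule inj_on_subset)
  have "differences G (graph_image \<alpha> B)
      = {# \<alpha> x \<otimes> inv (\<alpha> y). (x, y) \<in># mset_set (parcs B) #}"
    by (simp add: differences_def graph_image_def image_mset_mset_set[OF inj, symmetric]
        multiset.map_comp o_def case_prod_unfold)
  also have "\<dots> = image_mset \<alpha> (differences G B)"
    unfolding differences_def multiset.map_comp
    using True arcs by (intro image_mset_cong) auto
  finally show ?thesis .
next
  \<comment> \<open>By injectivity the image has infinitely many arcs too, and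
    \<open>mset_set\<close> of an infinite set is empty, so both sides vanish.\<close>
  case False
  have "inj_on (map_prod \<alpha> \<alpha>) (parcs B)"
    using map_prod_inj_on[OF \<alpha>(2) \<alpha>(2)] arcs by (rule inj_on_subset)
  with False show ?thesis
    by (simp add: differences_def graph_image_def finite_image_iff)
qed

text \<open>Exchanging the sums over blocks and automorphisms expresses everything through the
  images of one multiset, the form needed for counting along orbits.\<close>

lemma (in group) differences_family_developed_blocks:
  assumes "\<And>\<alpha>. \<alpha> \<in> A \<Longrightarrow> \<alpha> \<in> hom G G \<and> inj_on \<alpha> (carrier G)"
    and "\<And>B. B \<in># \<I> \<Longrightarrow> parcs B \<subseteq> carrier G \<times> carrier G"
  shows "differences_family G (developed_blocks A \<I>)
    = (\<Sum>\<alpha>\<in>A. image_mset \<alpha> (differences_family G \<I>))"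
  using assms(2)
proof (induction \<I>)
  case empty
  show ?case by (simp add: developed_blocks_def differences_family_def)
next
  case (add B \<I>)
  have "(\<Sum>\<alpha>\<in>A. differences G (graph_image \<alpha> B)) = (\<Sum>\<alpha>\<in>A. image_mset \<alpha> (differences G B))"
    using assms(1) add.prems by (intro sum.cong differences_graph_image) auto
  with add show ?case
    by (simp add: developed_blocks_def differences_family_def multiset.map_comp o_def
        sum_unfold_sum_mset[symmetric] sum.distrib)
qed

section \<open>Counting along orbits\<close>

text \<open>If \<open>h\<close> and \<open>k\<close> both move \<open>x\<close> to \<open>g\<close>,
  then \<open>inv h \<otimes> k\<close> fixes \<open>x\<close>, so semiregularity gives
  \<open>k = h\<close>. Existence is orbit membership, read backwards by symmetry of orbits.\<close>

lemma (in semiregular_action) card_transporter: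
  assumes x: "x \<in> E" and g: "g \<in> E"
  shows "card {h \<in> carrier G. \<phi> h x = g} = (if x \<in> orbit G \<phi> g then 1 else 0)"
proof (cases "x \<in> orbit G \<phi> g")
  case True
  interpret group G
    using group_hom group_hom.axioms(1) by auto
  obtain h where h: "h \<in> carrier G" "\<phi> h x = g"
    using orbit_sym[OF g x True] by (auto simp: orbit_def)
  have "k = h" if k: "k \<in> carrier G" "\<phi> k x = g" for k
  proof (rule ccontr)
    assume "k \<noteq> h"
    then have "inv h \<otimes> k \<noteq> \<one>"
      using h k by (metis inv_closed inv_equality inv_inv)
    moreover have "\<phi> (inv h \<otimes> k) x = x"
      using composition_rule[OF x, of "inv h" k] orbit_sym_aux[OF h(1) x h(2)] h k by simp
    ultimately show False
      using semiregular[of "inv h \<otimes> k" x] h k x by simp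
  qed
  with h have "{k \<in> carrier G. \<phi> k x = g} = {h}" by blast
  with True show ?thesis by simp
next
  case False
  then have "{h \<in> carrier G. \<phi> h x = g} = {}"
    using orbit_sym[OF x g] by (auto simp: orbit_def)
  then show ?thesis using False by (simp only: card.empty if_False)
qed

text \<open>Double counting: by \<open>card_transporter\<close>, each occurrence of \<open>x\<close>
  in \<open>D\<close> yields one copy of \<open>g\<close> if it lies in the orbit of
  \<open>g\<close>, and none otherwise.\<close>

lemma (in semiregular_action) count_sum_image_mset:
  assumes fin: "finite (carrier G)" and g: "g \<in> E" and D: "set_mset D \<subseteq> E"
  shows "count (\<Sum>h\<in>carrier G. image_mset (\<phi> h) D) g = size {# x \<in># D. x \<in> orbit G \<phi> g #}"
  using D
proof (induction D)
  case empty
  show ?case by simp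
next
  case (add x D)
  have "count (\<Sum>h\<in>carrier G. image_mset (\<phi> h) (add_mset x D)) g
      = (\<Sum>h\<in>carrier G. (if \<phi> h x = g then 1 else 0) + count (image_mset (\<phi> h) D) g)"
    unfolding count_sum by (intro sum.cong) auto
  also have "\<dots> = card {h \<in> carrier G. \<phi> h x = g}
      + size {# x \<in># D. x \<in> orbit G \<phi> g #}"
    using add fin by (simp add: sum.distrib count_sum sum.inter_filter[symmetric])
  also have "\<dots> = size {# x \<in># add_mset x D. x \<in> orbit G \<phi> g #}"
    using add.prems card_transporter[of x g] g by simp
  finally show ?case .
qed

theorem theorem5p11:
  fixes \<Gamma> :: "'v pair_pre_digraph"
    and G :: "('a, 'b) monoid_scheme"
    and H :: "'a set"
    and A :: "('a \<Rightarrow> 'a) set"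
    and \<I> :: "'a pair_pre_digraph multiset"
    and s m n t d lam :: nat
  assumes "pair_graph \<Gamma>" and "card (uedges \<Gamma>) = s"
    and "group G" and "finite (carrier G)" and "order G = m * n"
    and "0 < lam" and "0 < t" and "lam * (m - 1) * n = 2 * s * t"
    and "subgroup H G" and "card H = n"
    and "subgroup A (AutoGroup G)" and "card A = d" and "d dvd gcd (m * n - n) t"
    and "semiregular_action (Aut_subgroup G A) (carrier G - H) (restricted_action (carrier G - H))"
    and "size \<I> = t div d"
    and "\<forall>B\<in>#\<I>. iso_subgraph \<Gamma> (coset_multipartite G H) B"
    and "evenly_distributed (differences_family G \<I>)
           (orbits (Aut_subgroup G A) (carrier G - H) (restricted_action (carrier G - H)))"
  shows "relative_difference_family G H (m * n) n \<Gamma> lam (developed_blocks A \<I>)"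
proof -
  interpret group G by fact
  let ?E = "carrier G - H" and ?K = "coset_multipartite G H"
  let ?D = "differences_family G \<I>" and ?D' = "differences_family G (developed_blocks A \<I>)"
  interpret act: semiregular_action "Aut_subgroup G A" ?E "restricted_action ?E" by fact
  note verts = pverts_coset_multipartite[OF \<open>subgroup H G\<close>]
    and arcs = parcs_coset_multipartite[OF \<open>subgroup H G\<close>]

  have "A \<subseteq> auto G"
    using subgroup.subset[OF \<open>subgroup A (AutoGroup G)\<close>] by (simp add: AutoGroup_def)
  then have hom: "\<alpha> \<in> hom G G" and bij: "bij_betw \<alpha> (carrier G) (carrier G)" if "\<alpha> \<in> A" for \<alpha>
    using that by (auto simp: auto_def Bij_def)
  have "d dvd t" using assms(13) by simp
  \<comment> \<open>An infinite \<open>A\<close> would have cardinality 0, and 0 does not divide the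
    positive \<open>t\<close>.\<close>
  then have "finite A"
    using \<open>card A = d\<close> \<open>0 < t\<close> by (cases "finite A") auto

  have arc_carrier: "parcs B \<subseteq> carrier G \<times> carrier G" if "B \<in># \<I>" for B
    using iso_subgraph_parcs[OF bspec[OF assms(16) that]] arcs by auto
  have D': "?D' = (\<Sum>\<alpha>\<in>A. image_mset \<alpha> ?D)"
    using hom bij arc_carrier
    by (intro differences_family_developed_blocks) (auto simp: bij_betw_def)

  have D_E: "set_mset ?D \<subseteq> ?E"
  proof
    fix x assume "x \<in># ?D"
    then obtain B where B: "B \<in># \<I>" "x \<in># differences G B"
      by (auto simp: differences_family_def)
    then have "finite (parcs B)"
      using arc_carrier \<open>finite (carrier G)\<close> by (meson finite_SigmaI finite_subset)
    with B obtain u v where uv: "(u, v) \<in> parcs B" "x = u \<otimes>\<^bsub>G\<^esub> inv\<^bsub>G\<^esub> v"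
      by (auto simp: differences_def)
    with iso_subgraph_parcs[OF bspec[OF assms(16) B(1)]] have "(u, v) \<in> parcs ?K" by blast
    with uv arcs show "x \<in> ?E" by auto
  qed

  \<comment> \<open>Invariance is part of the restricted maps forming an action on
    \<open>?E\<close>.\<close>
  have E_invariant: "\<alpha> x \<in> ?E" if "\<alpha> \<in> A" "x \<in> ?E" for \<alpha> x
    using act.element_image[of \<alpha> x "\<alpha> x"] that by simp

  have blocks: "iso_subgraph \<Gamma> ?K (graph_image \<alpha> B)" if "B \<in># \<I>" "\<alpha> \<in> A" for B \<alpha>
  proof (rule iso_subgraph_graph_image)
    interpret \<alpha>: group_hom G G \<alpha>
      using hom[OF \<open>\<alpha> \<in> A\<close>] by unfold_locales
    show "iso_subgraph \<Gamma> ?K B" using assms(16) that by blast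
    show "inj_on \<alpha> (pverts ?K)" "\<alpha> ` pverts ?K \<subseteq> pverts ?K"
      using bij[OF \<open>\<alpha> \<in> A\<close>] by (auto simp: verts bij_betw_def)
    \<comment> \<open>The difference of the images is the image of the difference, which stays
      outside \<open>H\<close>.\<close>
    show "(\<alpha> x, \<alpha> y) \<in> parcs ?K" if "(x, y) \<in> parcs ?K" for x y
      using that E_invariant[OF \<open>\<alpha> \<in> A\<close>, of "x \<otimes>\<^bsub>G\<^esub> inv\<^bsub>G\<^esub> y"] by (simp add: arcs)
  qed

  obtain c where c: "size {# x \<in># ?D. x \<in> orbit (Aut_subgroup G A) (restricted_action ?E) g #} = c"
    if "g \<in> ?E" for g
    using assms(17) unfolding evenly_distributed_def orbits_def by blast
  have count_c: "count ?D' g = c" if "g \<in> ?E" for g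
  proof -
    \<comment> \<open>All of \<open>?D\<close> lies in \<open>?E\<close>, so restricting the
      automorphisms changes nothing and the orbit count applies.\<close>
    have "?D' = (\<Sum>\<alpha>\<in>A. image_mset (restrict \<alpha> ?E) ?D)"
      unfolding D' using D_E by (intro sum.cong image_mset_cong) auto
    then show ?thesis
      using act.count_sum_image_mset[OF _ that D_E] \<open>finite A\<close> c[OF that] by simp
  qed

  \<comment> \<open>Every block has as many arcs as \<open>\<Gamma>\<close>, namely
    \<open>2 * s\<close>.\<close>
  have "size ?D = (\<Sum>B\<in>#\<I>. 2 * s)"
    using assms(16) digraph_iso_card_arcs[where H = "with_proj \<Gamma>"]
      pair_graph.card_parcs[OF \<open>pair_graph \<Gamma>\<close>] \<open>card (uedges \<Gamma>) = s\<close>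
    unfolding differences_family_def size_mset_sum_mset_conv multiset.map_comp
    by (intro arg_cong[where f = sum_mset] image_mset_cong)
      (fastforce simp: size_differences iso_subgraph_def)
  then have size_D: "size ?D = t div d * (2 * s)"
    using \<open>size \<I> = t div d\<close> by simp
  have "size ?D' = (\<Sum>\<alpha>\<in>A. size ?D)"
    unfolding D' by simp
  then have "size ?D' = (d * (t div d)) * (2 * s)"
    using \<open>card A = d\<close> size_D by (simp only: sum_constant of_nat_id mult.assoc)
  then have "size ?D' = lam * (m - 1) * n"
    using \<open>d dvd t\<close> assms(8) by simp
  moreover have "set_mset ?D' \<subseteq> ?E"
  proof
    fix y assume "y \<in># ?D'"
    then obtain \<alpha> x where "\<alpha> \<in> A" "x \<in># ?D" "y = \<alpha> x"
      unfolding D' set_mset_sum[OF \<open>finite A\<close>] by auto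
    with D_E E_invariant[of \<alpha> x] show "y \<in> ?E" by blast
  qed
  \<comment> \<open>Elements of \<open>?E\<close> that do not occur contribute 0, so the sum may run
    over all of \<open>?E\<close>.\<close>
  then have "size ?D' = (\<Sum>g\<in>?E. count ?D' g)"
    using \<open>finite (carrier G)\<close> unfolding size_multiset_overloaded_eq
    by (intro sum.mono_neutral_left) (auto simp: not_in_iff)
  then have "size ?D' = card ?E * c"
    using count_c by simp
  moreover have "card ?E = (m - 1) * n"
    using card_Diff_subset[OF finite_subset, of H "carrier G" "carrier G"]
      subgroup.subset[OF \<open>subgroup H G\<close>]
      \<open>finite (carrier G)\<close> \<open>card H = n\<close> \<open>order G = m * n\<close>
    by (simp add: order_def diff_mult_distrib)
  ultimately have "card ?E * c = card ?E * lam" by auto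
  \<comment> \<open>The element \<open>g\<close> itself shows that the finite set \<open>?E\<close>
    is nonempty, which permits cancelling \<open>card ?E\<close>.\<close>
  then have "count ?D' g = lam" if "g \<in> ?E" for g
    using that count_c \<open>finite (carrier G)\<close> by (auto simp: card_eq_0_iff)
  then show ?thesis
    unfolding relative_difference_family_def
    using assms(3-5,9,10) blocks \<open>finite A\<close> by (auto simp: developed_blocks_def)
qed

end
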